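(* Let $A\in\mathbb{C}^{n\times n}$ have index $k$ and rank $r$, satisfy $\operatorname{rank}(A^{\sim}AA^{\sim})=\operatorname{rank}(A)$, and be written as $$A=U\begin{pmatrix}\Sigma K&\Sigma L\\ 0&0\end{pmatrix}U^{*},$$ where $U\in\mathbb{C}^{n\times n}$ is unitary, $\Sigma=\operatorname{diag}(\sigma_1,\dots,\sigma_r)$ is the diagonal matrix of the singular values $\sigma_i>0$ of $A$, and $K\in\mathbb{C}^{r\times r}$, $L\in\mathbb{C}^{r\times(n-r)}$ satisfy $KK^{*}+LL^{*}=I_r$. Let $G$ be the Minkowski metric matrix of order $n$, partitioned as $$G=U\begin{pmatrix}G_1&G_2\\ G_2^{*}&G_4\end{pmatrix}U^{*},\qquad G_1\in\mathbb{C}^{r\times r},\ G_2\in\mathbb{C}^{r\times(n-r)},\ G_4\in\mathbb{C}^{(n-r)\times(n-r)}.$$ Then $$A^{D,\mathfrak{m}}=U\begin{pmatrix}(\Sigma K)^{D}G_1^{-1}&0\\ 0&0\end{pmatrix}U^{*}G=U\begin{pmatrix}(\Sigma K)^{D}&(\Sigma K)^{D}G_1^{-1}G_2\\ 0&0\end{pmatrix}U^{*}.$$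
   Context: The index of $A\in\mathbb{C}^{n\times n}$ is the smallest nonnegative integer $k$ with $\operatorname{rank}(A^{k+1})=\operatorname{rank}(A^{k})$. The Minkowski metric matrix of order $n$ is $G=\operatorname{diag}(1,-I_{n-1})$. For $A\in\mathbb{C}^{n\times n}$, the Minkowski adjoint is $A^{\sim}=GA^{*}G$, where $A^*$ is the conjugate transpose. The Drazin inverse $A^{D}$ of a square matrix $A$ of index $k$ is the unique $X$ with $XAX=X$, $AX=XA$, $A^{k+1}X=A^{k}$. The Minkowski inverse $A^{\mathfrak{m}}$ is the unique matrix $X$ (if it exists) with $AXA=A$, $XAX=X$, $(AX)^{\sim}=AX$, $(XA)^{\sim}=XA$; it exists if and only if $\operatorname{rank}(A^{\sim}AA^{\sim})=\operatorname{rank}(A)$. When it exists, the $\mathfrak{m}$-DMP inverse of $A$ is $A^{D,\mathfrak{m}}=A^{D}AA^{\mathfrak{m}}$. Every $A\in\mathbb{C}^{n\times n}$ has a decomposition of the displayed form (the Hartwig–Spindelböck decomposition); under the rank hypothesis $G_1$ is nonsingular. *)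

theory Defs
  imports
    "HOL-Computational_Algebra.Polynomial"
    "Jordan_Normal_Form.DL_Rank"
    "Jordan_Normal_Form.Char_Poly"
    "Jordan_Normal_Form.Schur_Decomposition"
    "Jordan_Normal_Form.Gauss_Jordan_Elimination"
begin

abbreviation mat_rank :: "complex mat \<Rightarrow> nat" where
  "mat_rank A \<equiv> vec_space.rank (dim_row A) A"

definition mat_index :: "complex mat \<Rightarrow> nat" where
  "mat_index A = (LEAST k. mat_rank (A ^\<^sub>m (k + 1)) = mat_rank (A ^\<^sub>m k))"

definition unitary_mat :: "complex mat \<Rightarrow> bool" where
  "unitary_mat U \<longleftrightarrow> square_mat U \<and> inverts_mat U (mat_adjoint U) \<and> inverts_mat (mat_adjoint U) U"

text \<open>Singular values with multiplicity (zeros included): the square roots of the eigenvalues of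
  \<open>A\<^sup>* A\<close>, which are real and nonnegative, so that taking the real part loses nothing.\<close>

definition singular_values :: "complex mat \<Rightarrow> real multiset" where
  "singular_values A = image_mset (\<lambda>x. sqrt (Re x)) (proots (char_poly (mat_adjoint A * A)))"

definition minkowski_metric :: "nat \<Rightarrow> complex mat" where
  "minkowski_metric n = mat_diag n (\<lambda>i. if i = 0 then 1 else - 1)"

definition minkowski_adjoint :: "complex mat \<Rightarrow> complex mat" where
  "minkowski_adjoint A =
     minkowski_metric (dim_col A) * mat_adjoint A * minkowski_metric (dim_row A)"

definition is_drazin_inverse :: "complex mat \<Rightarrow> complex mat \<Rightarrow> bool" where
  "is_drazin_inverse A X \<longleftrightarrow>
     X \<in> carrier_mat (dim_row A) (dim_row A) \<and>
     X * A * X = X \<and> A * X = X * A \<and> A ^\<^sub>m (mat_index A + 1) * X = A ^\<^sub>m mat_index A"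

definition drazin_inverse :: "complex mat \<Rightarrow> complex mat" where
  "drazin_inverse A = (THE X. is_drazin_inverse A X)"

definition is_minkowski_inverse :: "complex mat \<Rightarrow> complex mat \<Rightarrow> bool" where
  "is_minkowski_inverse A X \<longleftrightarrow>
     X \<in> carrier_mat (dim_col A) (dim_row A) \<and>
     A * X * A = A \<and> X * A * X = X \<and>
     minkowski_adjoint (A * X) = A * X \<and> minkowski_adjoint (X * A) = X * A"

text \<open>Unspecified unless a Minkowski inverse exists, i.e. unless
  \<open>A\<^sup>~ A A\<^sup>~\<close> has the same rank as \<open>A\<close>.\<close>

definition minkowski_inverse :: "complex mat \<Rightarrow> complex mat" where
  "minkowski_inverse A = (THE X. is_minkowski_inverse A X)"

definition m_DMP_inverse :: "complex mat \<Rightarrow> complex mat" where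
  "m_DMP_inverse A = drazin_inverse A * A * minkowski_inverse A"

text \<open>The library's \<open>mat_inverse\<close> returns an option; this is its value for a nonsingular matrix.\<close>

abbreviation mat_inv :: "complex mat \<Rightarrow> complex mat" where
  "mat_inv B \<equiv> the (mat_inverse B)"

end

theory Submission
  imports Defs
begin

text \<open>The decomposition of \<open>A\<close> is in disguise a factorization \<open>A = P Q\<close> through dimension \<open>r\<close>, where \<open>P\<close>
  consists of the first \<open>r\<close> columns of \<open>U\<close> and \<open>Q = [\<Sigma>K \<Sigma>L] U\<^sup>*\<close>. In these terms the objects of the
  theorem are \<open>Q P = \<Sigma>K\<close>, \<open>P\<^sup>* G P = G\<^sub>1\<close> and \<open>P\<^sup>* G = [G\<^sub>1 G\<^sub>2] U\<^sup>*\<close>, and both right-hand sides are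
  equal to \<open>P D G\<^sub>1\<^sup>-\<^sup>1 P\<^sup>* G\<close>, where \<open>D\<close> is the Drazin inverse of \<open>Q P\<close>.

  That this is also the value of \<open>A\<^sup>D A A\<^sup>m\<close> follows from two formulas for factored matrices.
  Cline's formula (\<open>cline_formula\<close>) gives \<open>A\<^sup>D = P D\<^sup>2 Q\<close>. The Minkowski analogue of MacDuffee's formula for the
  Moore-Penrose inverse (\<open>mult_minkowski_inverse_factored\<close>) gives \<open>A A\<^sup>m = P G\<^sub>1\<^sup>-\<^sup>1 P\<^sup>* G\<close>, provided that the
  Gram matrices \<open>P\<^sup>* G P\<close> and \<open>Q G Q\<^sup>*\<close> are nonsingular. They are, because
  \<open>A\<^sup>~ A A\<^sup>~ = G Q\<^sup>* (P\<^sup>* G P) (Q G Q\<^sup>*) P\<^sup>* G\<close> has rank \<open>r\<close> (\<open>gram_matrices_nonsingular\<close>). The product of the two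
  formulas is \<open>P D\<^sup>2 (Q P) G\<^sub>1\<^sup>-\<^sup>1 P\<^sup>* G = P D G\<^sub>1\<^sup>-\<^sup>1 P\<^sup>* G\<close>.

  Both generalized inverses are defined by definite description, so they need existence and uniqueness. For the
  Drazin inverse, existence follows from Cline's formula by induction on the order of the matrix. Its
  definition refers to the index, which is a statement about ranks; it is tied to the matrix equations by
  \<open>is_drazin_inverse_iff\<close>.\<close>

section \<open>Rank and factorizations\<close>

text \<open>Associativity with the dimension conditions as equations between dimensions: in this form the
  simplifier can discharge them for rectangular products, and reassociates any product to the right.\<close>

lemma mult_assoc_dim:
  "dim_col A = dim_row B \<Longrightarrow> dim_col B = dim_row C \<Longrightarrow> A * B * C = A * (B * (C :: 'a :: semiring_0 mat))"
  by (rule assoc_mult_mat) auto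

context vec_space begin

lemma rank_mult_le:
  assumes X: "X \<in> carrier_mat n c" and Y: "Y \<in> carrier_mat c d"
  shows "rank (X * Y) \<le> rank X"
    and "span (set (cols (X * Y))) \<subseteq> span (set (cols X))"
proof -
  have X': "set (cols X) \<subseteq> carrier_vec n" using X cols_dim by blast
  have XY: "X * Y \<in> carrier_mat n d" using X Y by simp
  have XY': "set (cols (X * Y)) \<subseteq> carrier_vec n" using XY cols_dim by blast
  have "set (cols (X * Y)) \<subseteq> span (set (cols X))"
  proof
    fix v assume "v \<in> set (cols (X * Y))"
    then obtain j where j: "j < d" "v = col (X * Y) j"
      using X Y by (auto simp: in_set_conv_nth)
    hence v: "v = X *\<^sub>v col Y j" using X Y by auto
    have "v \<in> col_space X"
      unfolding col_space_eq[OF X] using v j X Y by auto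
    thus "v \<in> span (set (cols X))" unfolding col_space_def .
  qed
  thus sub: "span (set (cols (X * Y))) \<subseteq> span (set (cols X))"
    using X' span_is_subset span_is_submodule by meson
  let ?V1 = "span (set (cols X))" and ?V2 = "span (set (cols (X * Y)))"
  have s1: "VectorSpace.subspace class_ring ?V1 V" and s2: "VectorSpace.subspace class_ring ?V2 V"
    using X' XY' span_is_subspace by auto
  have f1: "vectorspace.fin_dim class_ring (vs ?V1)" "vectorspace.fin_dim class_ring (vs ?V2)"
    using X XY fin_dim_span_cols by auto
  show "rank (X * Y) \<le> rank X" unfolding rank_def
    using vectorspace.subspace_dim[OF subspace_is_vs[OF s1] nested_subspaces[OF s1 s2 sub]] f1 by simp
qed

lemma maximal_independent_columns:
  assumes X: "X \<in> carrier_mat n c"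
  obtains S where "maximal S (\<lambda>T. T \<subseteq> set (cols X) \<and> lin_indpt T)"
    and "S \<subseteq> set (cols X)" and "lin_indpt S" and "finite S" and "card S = rank X"
proof -
  obtain S where S: "maximal S (\<lambda>T. T \<subseteq> set (cols X) \<and> lin_indpt T)"
    using maximal_exists[of "(\<lambda>T. T \<subseteq> set (cols X) \<and> lin_indpt T)" "card (set (cols X))" "{}"]
    by (meson List.finite_set card_mono empty_iff empty_subsetI finite_lin_indpt2 rev_finite_subset)
  hence "S \<subseteq> set (cols X)" "lin_indpt S" by (auto simp: maximal_def)
  moreover from this have "finite S" using finite_subset by blast
  ultimately show thesis using that S rank_card_indpt[OF X S] by simp
qed

text \<open>A column of \<open>X\<close> in the column space of \<open>P\<close> has the form \<open>P *\<^sub>v x\<close>; the vectors \<open>x\<close> are the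
  columns of the second factor.\<close>

lemma mat_factor_through_span:
  assumes X: "X \<in> carrier_mat n c" and P: "P \<in> carrier_mat n m"
    and sub: "set (cols X) \<subseteq> span (set (cols P))"
  shows "\<exists>Q \<in> carrier_mat m c. X = P * Q"
proof -
  have "\<exists>x \<in> carrier_vec m. P *\<^sub>v x = col X j" if "j < c" for j
  proof -
    have "col X j \<in> col_space P" unfolding col_space_def
      using sub that X by (metis cols_length cols_nth carrier_matD(2) nth_mem subsetD)
    thus ?thesis unfolding col_space_eq[OF P] using P by auto
  qed
  then obtain f where f: "\<And>j. j < c \<Longrightarrow> f j \<in> carrier_vec m \<and> P *\<^sub>v f j = col X j" by metis
  define Q where "Q = mat_of_cols m (map f [0..<c])"
  have Q: "Q \<in> carrier_mat m c" unfolding Q_def by (metis length_map length_upt diff_zero mat_of_cols_carrier(1))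
  have colQ: "col Q j = f j" if "j < c" for j
    unfolding Q_def using that f by (subst col_mat_of_cols) auto
  have "X = P * Q"
  proof (rule mat_col_eqI)
    fix j assume "j < dim_col (P * Q)"
    hence j: "j < c" using Q by simp
    show "col X j = col (P * Q) j"
      using P Q j f[OF j] colQ[OF j] by (simp add: col_mult2[OF P Q j])
  qed (use X P Q in auto)
  thus ?thesis using Q by blast
qed

text \<open>Full-rank factorization: a maximal independent set of columns already spans all columns, because
  a column outside its span could be added to it.\<close>

lemma rank_factorization:
  assumes X: "X \<in> carrier_mat n c"
  shows "\<exists>P \<in> carrier_mat n (rank X). \<exists>Q \<in> carrier_mat (rank X) c. X = P * Q"
proof -
  have X': "set (cols X) \<subseteq> carrier_vec n" using X cols_dim by blast
  obtain S where S: "maximal S (\<lambda>T. T \<subseteq> set (cols X) \<and> lin_indpt T)"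
    and Sc: "S \<subseteq> set (cols X)" and li: "lin_indpt S" and finS: "finite S" and card: "card S = rank X"
    using maximal_independent_columns[OF X] by blast
  have SV: "S \<subseteq> carrier_vec n" using Sc X' by blast
  obtain ss where ss: "set ss = S" "distinct ss" using finite_distinct_list[OF finS] by blast
  define P where "P = mat_of_cols n ss"
  have P: "P \<in> carrier_mat n (rank X)"
    unfolding P_def using ss card distinct_card by (metis mat_of_cols_carrier(1))
  have colsP: "cols P = ss" unfolding P_def using SV ss by (simp add: cols_mat_of_cols)
  have "set (cols X) \<subseteq> span S"
  proof
    fix v assume v: "v \<in> set (cols X)"
    show "v \<in> span S"
    proof (rule ccontr)
      assume nv: "v \<notin> span S"
      have vS: "v \<notin> S" using nv SV span_mem by auto
      have "lin_indpt (S \<union> {v})"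
        using lin_dep_iff_in_span[of S v] SV li X' v vS nv by auto
      hence "S \<union> {v} \<subseteq> set (cols X) \<and> lin_indpt (S \<union> {v})" using Sc v by auto
      hence "S \<union> {v} = S" using S unfolding maximal_def by blast
      thus False using vS by blast
    qed
  qed
  thus ?thesis using mat_factor_through_span[OF X P] P unfolding colsP ss(1) by blast
qed

text \<open>If multiplying on the right by \<open>Z\<close> does not lower the rank, then the column space of \<open>X * Z\<close>, which
  is contained in that of \<open>X\<close>, has the same dimension and so is equal to it. Thus the columns of
  \<open>X\<close> can be recovered from those of \<open>X * Z\<close>. With \<open>X\<close> a power of a matrix \<open>A\<close> and \<open>Z = A\<close> this turns
  the rank condition in the definition of the index into an identity between powers.\<close>

lemma rank_mult_eq_imp_factor:
  assumes X: "X \<in> carrier_mat n c" and Z: "Z \<in> carrier_mat c d"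
    and eq: "rank (X * Z) = rank X"
  shows "\<exists>Y \<in> carrier_mat d c. X = X * Z * Y"
proof -
  let ?V1 = "span (set (cols X))" and ?V2 = "span (set (cols (X * Z)))"
  have XZ: "X * Z \<in> carrier_mat n d" using X Z by simp
  have X': "set (cols X) \<subseteq> carrier_vec n" using X cols_dim by blast
  have XZ': "set (cols (X * Z)) \<subseteq> carrier_vec n" using XZ cols_dim by blast
  have sub: "?V2 \<subseteq> ?V1" by (rule rank_mult_le(2)[OF X Z])
  have s1: "VectorSpace.subspace class_ring ?V1 V" using X' span_is_subspace by auto
  have m1: "submodule class_ring ?V1 V" using X' span_is_submodule by auto
  interpret W: vectorspace class_ring "vs ?V1" by (rule subspace_is_vs[OF s1])
  obtain S where Sc: "S \<subseteq> set (cols (X * Z))" and li: "lin_indpt S" and finS: "finite S"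
    and card: "card S = rank X"
    using maximal_independent_columns[OF XZ] eq by metis
  have SV: "S \<subseteq> ?V1" using Sc sub in_own_span[OF XZ'] by blast
  have "W.basis S"
  proof (rule W.dim_li_is_basis)
    show "W.fin_dim" using X fin_dim_span_cols by auto
    show "finite S" by (rule finS)
    show "S \<subseteq> carrier (vs ?V1)" using SV by simp
    show "W.lin_indpt S" using span_li_not_depend(2)[OF SV m1] li by simp
    show "W.dim \<le> card S" using card unfolding rank_def by simp
  qed
  hence "W.span S = ?V1" unfolding W.basis_def by simp
  hence "span S = ?V1" using span_li_not_depend(1)[OF SV m1] by simp
  hence "set (cols X) \<subseteq> span S" using in_own_span[OF X'] by simp
  also have "span S \<subseteq> ?V2" by (rule span_is_monotone[OF Sc])
  finally have "set (cols X) \<subseteq> ?V2" .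
  thus ?thesis using mat_factor_through_span[OF X XZ] by simp
qed

text \<open>A singular \<open>N\<close> would itself factor through a dimension smaller than \<open>r\<close>, and so would the whole
  product.\<close>

lemma middle_factor_nonsingular:
  assumes X: "X \<in> carrier_mat n r" and N: "N \<in> carrier_mat r r" and Y: "Y \<in> carrier_mat r m"
    and rk: "rank (X * N * Y) = r"
  shows "det N \<noteq> 0"
proof
  assume "det N = 0"
  then have lt: "vec_space.rank r N < r" (is "?s < r") using vec_space.det_zero_low_rank[OF N] by simp
  obtain P Q where P: "P \<in> carrier_mat r ?s" and Q: "Q \<in> carrier_mat ?s r" and "N = P * Q"
    using vec_space.rank_factorization[OF N] by blast
  hence "X * N * Y = (X * P) * (Q * Y)"
    using carrier_matD[OF X] carrier_matD[OF Y] carrier_matD[OF P] carrier_matD[OF Q] by (simp add: mult_assoc_dim)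
  moreover have XP: "X * P \<in> carrier_mat n ?s" and QY: "Q * Y \<in> carrier_mat ?s m" using X P Q Y by auto
  ultimately have "rank (X * N * Y) \<le> rank (X * P)" using rank_mult_le(1)[OF XP QY] by simp
  also have "\<dots> \<le> ?s" using rank_le_nc[OF XP] .
  finally show False using rk lt by simp
qed

end

section \<open>Inverses of matrices with nonzero determinant\<close>

lemma inverse_exists:
  assumes N: "N \<in> carrier_mat r r" and "det N \<noteq> (0 :: 'a :: field)"
  shows "\<exists>M \<in> carrier_mat r r. M * N = 1\<^sub>m r \<and> N * M = 1\<^sub>m r"
  using det_non_zero_imp_unit[OF assms, of "()"] by (auto simp: Units_def ring_mat_def)

lemma mat_inv_nonsingular:
  assumes N: "N \<in> carrier_mat r r" and "det N \<noteq> 0"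
  shows "mat_inv N \<in> carrier_mat r r" "N * mat_inv N = 1\<^sub>m r" "mat_inv N * N = 1\<^sub>m r"
proof -
  obtain M where "mat_inverse N = Some M"
    using mat_inverse(1)[OF N, of "()"] det_non_zero_imp_unit[OF assms, of "()"] by (cases "mat_inverse N") auto
  thus "mat_inv N \<in> carrier_mat r r" "N * mat_inv N = 1\<^sub>m r" "mat_inv N * N = 1\<^sub>m r"
    using mat_inverse(2)[OF N] by auto
qed

section \<open>The Drazin inverse\<close>

lemma pow_mat_Suc_left:
  assumes "A \<in> carrier_mat n n"
  shows "A ^\<^sub>m Suc k = A * A ^\<^sub>m k"
proof (induction k)
  case (Suc k)
  have "A ^\<^sub>m Suc (Suc k) = (A * A ^\<^sub>m k) * A" using Suc by simp
  also have "\<dots> = A * A ^\<^sub>m Suc k" using assms by (simp add: mult_assoc_dim)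
  finally show ?case .
qed (use assms in auto)

lemma pow_mat_commute:
  assumes A: "A \<in> carrier_mat n n" and X: "X \<in> carrier_mat n n" and AX: "A * X = X * A"
  shows "X * A ^\<^sub>m j = A ^\<^sub>m j * (X :: 'a :: semiring_1 mat)"
proof (induction j)
  case 0 show ?case using A X by simp
next
  case (Suc j)
  note d = carrier_matD[OF A] carrier_matD[OF X]
  have "X * A ^\<^sub>m Suc j = (X * A ^\<^sub>m j) * A" using d by (simp add: mult_assoc_dim)
  also have "\<dots> = A ^\<^sub>m j * (A * X)" unfolding Suc AX using d by (simp add: mult_assoc_dim)
  also have "\<dots> = A ^\<^sub>m Suc j * X" using d by (simp add: mult_assoc_dim)
  finally show ?case .
qed

text \<open>The Drazin conditions with an unspecified exponent in place of the index. The index of a product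
  \<open>P * Q\<close> and that of \<open>Q * P\<close> can differ by one, and leaving the exponent open makes Cline's formula
  independent of this; \<open>is_drazin_inverse_iff\<close> shows that the two notions agree.\<close>

definition drazin_equations :: "complex mat \<Rightarrow> complex mat \<Rightarrow> bool" where
  "drazin_equations A X \<longleftrightarrow> X \<in> carrier_mat (dim_row A) (dim_row A) \<and>
     X * A * X = X \<and> A * X = X * A \<and> (\<exists>k. A ^\<^sub>m (k + 1) * X = A ^\<^sub>m k)"

text \<open>From \<open>X = A * X * X = X * X * A\<close>, by iteration: \<open>X\<close> contains arbitrarily high powers of \<open>A\<close> as
  factors.\<close>

lemma outer_inverse_power_factor:
  assumes A: "A \<in> carrier_mat n n" and X: "X \<in> carrier_mat n n"
    and XAX: "X * A * X = X" and AX: "A * X = X * A"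
  shows "A ^\<^sub>m m * X ^\<^sub>m (m + 1) = X" and "X ^\<^sub>m (m + 1) * A ^\<^sub>m m = X"
proof (induction m)
  case 0
  { case 1 show ?case using A X by simp }
  { case 2 show ?case using A X by simp }
next
  case (Suc m)
  note d = carrier_matD[OF A] carrier_matD[OF X]
  { case 1
    have "A ^\<^sub>m Suc m * X ^\<^sub>m (Suc m + 1) = A * (A ^\<^sub>m m * X ^\<^sub>m (m + 1)) * X"
      unfolding pow_mat_Suc_left[OF A] using d by (simp add: mult_assoc_dim)
    also have "\<dots> = X" using XAX AX unfolding Suc(1) by simp
    finally show ?case . }
  { case 2
    have "X ^\<^sub>m (Suc m + 1) * A ^\<^sub>m Suc m = X * (X ^\<^sub>m (m + 1) * A ^\<^sub>m m) * A"
      using pow_mat_Suc_left[OF X, of "Suc m"] d by (simp add: mult_assoc_dim)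
    also have "\<dots> = X * (A * X)" using d unfolding Suc(2) AX by (simp add: mult_assoc_dim)
    also have "\<dots> = X" using XAX d by (simp add: mult_assoc_dim)
    finally show ?case . }
qed

text \<open>The matrix \<open>Y * A = A * Y\<close> acts as the identity on high powers of \<open>A\<close>, and \<open>X\<close> has such a power as
  its left and as its right factor.\<close>

lemma drazin_absorb:
  assumes A: "A \<in> carrier_mat n n" and X: "drazin_equations A X" and Y: "drazin_equations A Y"
  shows "Y * A * X = X" and "X * A * Y = X"
proof -
  from X A have Xc: "X \<in> carrier_mat n n" and XAX: "X * A * X = X" and AX: "A * X = X * A"
    by (auto simp: drazin_equations_def)
  from Y A obtain k where Yc: "Y \<in> carrier_mat n n" and AY: "A * Y = Y * A"
    and k: "A ^\<^sub>m Suc k * Y = A ^\<^sub>m k" by (auto simp: drazin_equations_def)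
  note d = carrier_matD[OF A] carrier_matD[OF Xc] carrier_matD[OF Yc]
  note F = outer_inverse_power_factor[OF A Xc XAX AX, of k]
  have "Y * A * X = Y * A * (A ^\<^sub>m k * X ^\<^sub>m (k + 1))" unfolding F ..
  also have "\<dots> = (Y * (A * A ^\<^sub>m k)) * X ^\<^sub>m (k + 1)" using d by (simp add: mult_assoc_dim)
  also have "Y * (A * A ^\<^sub>m k) = A ^\<^sub>m k" using k pow_mat_commute[OF A Yc AY, of "Suc k"] pow_mat_Suc_left[OF A, of k] by simp
  finally show "Y * A * X = X" unfolding F .
  have "X * A * Y = X ^\<^sub>m (k + 1) * A ^\<^sub>m k * A * Y" unfolding F ..
  also have "\<dots> = X ^\<^sub>m (k + 1) * (A ^\<^sub>m Suc k * Y)" using d by (simp add: mult_assoc_dim)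
  finally show "X * A * Y = X" unfolding k F .
qed

lemma drazin_equations_unique:
  assumes A: "A \<in> carrier_mat n n" and X: "drazin_equations A X" and Y: "drazin_equations A Y"
  shows "X = Y"
  using drazin_absorb[OF A X Y] drazin_absorb[OF A Y X] by simp

lemma pow_mat_swap:
  assumes P: "P \<in> carrier_mat n r" and Q: "Q \<in> carrier_mat r n"
  shows "(P * Q) ^\<^sub>m Suc k = P * (Q * P) ^\<^sub>m k * (Q :: 'a :: semiring_1 mat)"
proof (induction k)
  case 0
  show ?case using P Q by simp
next
  case (Suc k)
  have "(P * Q) ^\<^sub>m Suc (Suc k) = (P * (Q * P) ^\<^sub>m k * Q) * (P * Q)" unfolding Suc[symmetric] by simp
  also have "\<dots> = P * (Q * P) ^\<^sub>m Suc k * Q" using P Q by (simp add: mult_assoc_dim)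
  finally show ?case .
qed

text \<open>Cline's formula: the Drazin inverse of \<open>P * Q\<close> is obtained from that of the possibly much smaller matrix
  \<open>Q * P\<close>. All conditions reduce to those for \<open>D\<close> because \<open>P * Q * (P * D\<^sup>2 * Q)\<close> and
  \<open>(P * D\<^sup>2 * Q) * (P * Q)\<close> are both equal to \<open>P * D * Q\<close>.\<close>

lemma cline_formula:
  assumes P: "P \<in> carrier_mat n r" and Q: "Q \<in> carrier_mat r n"
    and D: "drazin_equations (Q * P) D"
  shows "drazin_equations (P * Q) (P * (D * D) * Q)"
proof -
  define B where "B = Q * P"
  have B: "B \<in> carrier_mat r r" unfolding B_def using P Q by simp
  from D B obtain k where Dc: "D \<in> carrier_mat r r" and DBD: "D * B * D = D" and BD: "B * D = D * B"
    and k: "B ^\<^sub>m Suc k * D = B ^\<^sub>m k" unfolding B_def[symmetric] by (auto simp: drazin_equations_def)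
  note d = carrier_matD[OF P] carrier_matD[OF Q] carrier_matD[OF Dc] carrier_matD[OF B]
  have BDD: "B * (D * D) = D" and DDB: "D * D * B = D"
  proof -
    have "B * (D * D) = (B * D) * D" using d by (simp add: mult_assoc_dim)
    thus "B * (D * D) = D" unfolding BD DBD .
    have "D * D * B = D * (B * D)" unfolding BD using d by (simp add: mult_assoc_dim)
    thus "D * D * B = D" using DBD d by (simp add: mult_assoc_dim)
  qed
  have l: "P * Q * (P * (D * D) * Q) = P * D * Q"
  proof -
    have "P * Q * (P * (D * D) * Q) = P * (B * (D * D)) * Q" unfolding B_def using d by (simp add: mult_assoc_dim)
    thus ?thesis unfolding BDD .
  qed
  have rr: "P * (D * D) * Q * (P * Q) = P * D * Q"
  proof -
    have "P * (D * D) * Q * (P * Q) = P * (D * D * B) * Q" unfolding B_def using d by (simp add: mult_assoc_dim)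
    thus ?thesis unfolding DDB .
  qed
  have "P * (D * D) * Q * (P * Q) * (P * (D * D) * Q) = P * D * Q * (P * (D * D) * Q)"
    unfolding rr ..
  also have "\<dots> = P * (D * B * D) * D * Q" unfolding B_def using d by (simp add: mult_assoc_dim)
  also have "\<dots> = P * (D * D) * Q" unfolding DBD using d by (simp add: mult_assoc_dim)
  finally have m: "P * (D * D) * Q * (P * Q) * (P * (D * D) * Q) = P * (D * D) * Q" .
  have "(P * Q) ^\<^sub>m (Suc k + 1) * (P * (D * D) * Q) = (P * B ^\<^sub>m Suc k * Q) * (P * (D * D) * Q)"
    using pow_mat_swap[OF P Q, of "Suc k"] unfolding B_def by simp
  also have "\<dots> = P * B ^\<^sub>m Suc k * (B * (D * D)) * Q" unfolding B_def using d by (simp add: mult_assoc_dim)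
  also have "\<dots> = P * (B ^\<^sub>m Suc k * D) * Q" unfolding BDD using d by (simp add: mult_assoc_dim)
  also have "\<dots> = (P * Q) ^\<^sub>m Suc k" unfolding k using pow_mat_swap[OF P Q, of k] unfolding B_def by simp
  finally have "\<exists>k. (P * Q) ^\<^sub>m (k + 1) * (P * (D * D) * Q) = (P * Q) ^\<^sub>m k" by blast
  thus ?thesis using m l rr d unfolding drazin_equations_def by auto
qed

text \<open>Induction on the order: a nonsingular matrix has its inverse as Drazin inverse, and a singular matrix
  factors through a smaller dimension, where Cline's formula applies.\<close>

lemma drazin_equations_exist:
  assumes "A \<in> carrier_mat n n"
  shows "\<exists>X. drazin_equations A X"
  using assms
proof (induction n arbitrary: A rule: less_induct)
  case (less n)
  note A = less.prems
  show ?case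
  proof (cases "det A = 0")
    case False
    then obtain M where "M \<in> carrier_mat n n" "M * A = 1\<^sub>m n" "A * M = 1\<^sub>m n"
      using inverse_exists[OF A] by blast
    hence "drazin_equations A M" using A unfolding drazin_equations_def by (auto intro!: exI[of _ 0])
    thus ?thesis by blast
  next
    case True
    interpret vec_space "TYPE(complex)" n .
    have lt: "rank A < n" using det_zero_low_rank[OF A True] .
    obtain P Q where P: "P \<in> carrier_mat n (rank A)" and Q: "Q \<in> carrier_mat (rank A) n" and PQ: "A = P * Q"
      using rank_factorization[OF A] by blast
    obtain D where "drazin_equations (Q * P) D" using less.IH[OF lt mult_carrier_mat[OF Q P]] by blast
    from cline_formula[OF P Q this] show ?thesis unfolding PQ by blast
  qed
qed

text \<open>The minimum in the definition of the index is attained: by \<open>A ^\<^sub>m (k + 1) * X = A ^\<^sub>m k\<close>, the rank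
  is stable at any exponent \<open>k\<close> that belongs to a solution \<open>X\<close> of the Drazin equations.\<close>

lemma rank_power_index:
  assumes A: "A \<in> carrier_mat n n"
  shows "mat_rank (A ^\<^sub>m (mat_index A + 1)) = mat_rank (A ^\<^sub>m mat_index A)"
proof -
  interpret vec_space "TYPE(complex)" n .
  obtain X k where X: "X \<in> carrier_mat n n" and k: "A ^\<^sub>m (k + 1) * X = A ^\<^sub>m k"
    using drazin_equations_exist[OF A] A unfolding drazin_equations_def by auto
  have Ak: "A ^\<^sub>m j \<in> carrier_mat n n" for j using A by simp
  have "rank (A ^\<^sub>m k) \<le> rank (A ^\<^sub>m (k + 1))" using rank_mult_le(1)[OF Ak X] k by metis
  moreover have "rank (A ^\<^sub>m (k + 1)) \<le> rank (A ^\<^sub>m k)" using rank_mult_le(1)[OF Ak A] by simp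
  ultimately have "mat_rank (A ^\<^sub>m (k + 1)) = mat_rank (A ^\<^sub>m k)" using A by simp
  thus ?thesis unfolding mat_index_def by (rule LeastI)
qed

text \<open>The nontrivial direction has to lower the exponent \<open>k\<close> to the index \<open>i\<close>. Equality of the ranks of
  \<open>A ^\<^sub>m i\<close> and \<open>A ^\<^sub>m (i + 1)\<close> gives \<open>A ^\<^sub>m i = A ^\<^sub>m (i + 1) * Y\<close>, hence by iteration
  \<open>A ^\<^sub>m i = A ^\<^sub>m k * W\<close>. Since \<open>X * A\<close> fixes \<open>A ^\<^sub>m k\<close>, it also fixes \<open>A ^\<^sub>m i\<close>.\<close>

lemma is_drazin_inverse_iff:
  assumes A: "A \<in> carrier_mat n n"
  shows "is_drazin_inverse A X \<longleftrightarrow> drazin_equations A X"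
proof
  assume "is_drazin_inverse A X"
  thus "drazin_equations A X" unfolding is_drazin_inverse_def drazin_equations_def by blast
next
  assume D: "drazin_equations A X"
  interpret vec_space "TYPE(complex)" n .
  from D A obtain k where X: "X \<in> carrier_mat n n" and AX: "A * X = X * A"
    and k: "A ^\<^sub>m (k + 1) * X = A ^\<^sub>m k" by (auto simp: drazin_equations_def)
  define i where "i = mat_index A"
  have Ak: "A ^\<^sub>m j \<in> carrier_mat n n" for j using A by simp
  have "rank (A ^\<^sub>m i * A) = rank (A ^\<^sub>m i)"
    using rank_power_index[OF A] A unfolding i_def by simp
  then obtain Y where Y: "Y \<in> carrier_mat n n" and iY: "A ^\<^sub>m i = A ^\<^sub>m i * A * Y"
    using rank_mult_eq_imp_factor[OF Ak A] by blast
  note d = carrier_matD[OF A] carrier_matD[OF X] carrier_matD[OF Y] carrier_matD[OF Ak]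
  have "\<exists>W \<in> carrier_mat n n. A ^\<^sub>m i = A ^\<^sub>m m * W" for m
  proof (induction m)
    case 0
    show ?case using A by (intro bexI[of _ "A ^\<^sub>m i"]) auto
  next
    case (Suc m)
    then obtain W where W: "W \<in> carrier_mat n n" and im: "A ^\<^sub>m i = A ^\<^sub>m m * W" by blast
    have "A ^\<^sub>m i = A * A ^\<^sub>m i * Y" using iY pow_mat_Suc_left[OF A, of i] by simp
    also have "\<dots> = A * (A ^\<^sub>m m * W) * Y" unfolding im ..
    also have "\<dots> = A ^\<^sub>m Suc m * (W * Y)"
      unfolding pow_mat_Suc_left[OF A] using d carrier_matD[OF W] by (simp add: mult_assoc_dim)
    finally show ?case using W Y by (intro bexI[of _ "W * Y"]) auto
  qed
  then obtain W where W: "W \<in> carrier_mat n n" and ik: "A ^\<^sub>m i = A ^\<^sub>m k * W" by blast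
  have "A ^\<^sub>m (i + 1) * X = X * (A * A ^\<^sub>m i)"
    using pow_mat_commute[OF A X AX, of "Suc i"] pow_mat_Suc_left[OF A, of i] by simp
  also have "\<dots> = X * (A * A ^\<^sub>m k) * W" unfolding ik using d carrier_matD[OF W] by (simp add: mult_assoc_dim)
  also have "X * (A * A ^\<^sub>m k) = A ^\<^sub>m k"
    using pow_mat_commute[OF A X AX, of "Suc k"] pow_mat_Suc_left[OF A, of k] k by simp
  finally show "is_drazin_inverse A X"
    using D unfolding ik[symmetric] is_drazin_inverse_def drazin_equations_def i_def by blast
qed

lemma drazin_inverse_eqI:
  assumes A: "A \<in> carrier_mat n n" and X: "drazin_equations A X"
  shows "drazin_inverse A = X"
  unfolding drazin_inverse_def is_drazin_inverse_iff[OF A]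
  using X drazin_equations_unique[OF A] by blast

lemma drazin_inverse_equations:
  assumes A: "A \<in> carrier_mat n n"
  shows "drazin_equations A (drazin_inverse A)"
  using drazin_equations_exist[OF A] drazin_inverse_eqI[OF A] by metis

section \<open>The conjugate transpose\<close>

lemma dim_mat_adjoint [simp]:
  "dim_row (mat_adjoint A) = dim_col A" "dim_col (mat_adjoint A) = dim_row A"
  by (simp_all add: mat_adjoint_def)

lemma index_mat_adjoint:
  "i < dim_col A \<Longrightarrow> j < dim_row A \<Longrightarrow> mat_adjoint A $$ (i, j) = conjugate (A $$ (j, i))"
  by (simp add: mat_adjoint_def mat_of_rows_index)

lemma mat_adjoint_adjoint [simp]: "mat_adjoint (mat_adjoint A) = A"
  by (rule eq_matI) (simp_all add: index_mat_adjoint)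

lemma mat_adjoint_mult:
  assumes "dim_col A = dim_row B"
  shows "mat_adjoint (A * B) = mat_adjoint B * mat_adjoint (A :: complex mat)"
proof (rule eq_matI)
  fix i j assume "i < dim_row (mat_adjoint B * mat_adjoint A)" "j < dim_col (mat_adjoint B * mat_adjoint A)"
  hence ij: "i < dim_col B" "j < dim_row A" by auto
  have "mat_adjoint (A * B) $$ (i, j) = (\<Sum>k = 0..<dim_row B. cnj (A $$ (j, k)) * cnj (B $$ (k, i)))"
    using ij assms by (simp add: index_mat_adjoint scalar_prod_def)
  also have "\<dots> = (mat_adjoint B * mat_adjoint A) $$ (i, j)"
    using ij assms by (simp add: index_mat_adjoint scalar_prod_def mult.commute)
  finally show "mat_adjoint (A * B) $$ (i, j) = (mat_adjoint B * mat_adjoint A) $$ (i, j)" .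
qed simp_all

lemma mat_adjoint_one [simp]: "mat_adjoint (1\<^sub>m n) = (1\<^sub>m n :: complex mat)"
  by (rule eq_matI) (auto simp: index_mat_adjoint)

lemma mat_adjoint_zero [simp]: "mat_adjoint (0\<^sub>m n m) = (0\<^sub>m m n :: complex mat)"
  by (rule eq_matI) (auto simp: index_mat_adjoint)

lemma mat_adjoint_four_block:
  fixes A B C D :: "complex mat"
  assumes "A \<in> carrier_mat n1 m1" "B \<in> carrier_mat n1 m2" "C \<in> carrier_mat n2 m1" "D \<in> carrier_mat n2 m2"
  shows "mat_adjoint (four_block_mat A B C D) =
    four_block_mat (mat_adjoint A) (mat_adjoint C) (mat_adjoint B) (mat_adjoint D)"
  by (rule eq_matI) (use assms in \<open>auto simp: index_mat_adjoint\<close>)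

lemma mat_adjoint_inverse_hermitian:
  assumes N: "N \<in> carrier_mat r r" and M: "M \<in> carrier_mat r r"
    and MN: "M * N = 1\<^sub>m r" and herm: "mat_adjoint N = (N :: complex mat)"
  shows "mat_adjoint M = M"
proof -
  have "N * mat_adjoint M = 1\<^sub>m r"
    using arg_cong[OF MN, of mat_adjoint] M N herm by (simp add: mat_adjoint_mult)
  hence "M * (N * mat_adjoint M) = M" using M by simp
  moreover have "M * (N * mat_adjoint M) = (M * N) * mat_adjoint M" using M N by (simp add: mult_assoc_dim)
  moreover have "1\<^sub>m r * mat_adjoint M = mat_adjoint M" using M by (intro left_mult_one_mat) auto
  ultimately show ?thesis using MN by simp
qed

section \<open>The Minkowski inverse\<close>

lemma dim_minkowski_metric [simp]:
  "dim_row (minkowski_metric n) = n" "dim_col (minkowski_metric n) = n"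
  by (simp_all add: minkowski_metric_def mat_diag_def)

lemma minkowski_metric_sq [simp]: "minkowski_metric n * minkowski_metric n = 1\<^sub>m n"
  unfolding minkowski_metric_def mat_diag_diag by (rule eq_matI) (auto simp: mat_diag_def)

lemma minkowski_metric_sq_left [simp]:
  "dim_row B = n \<Longrightarrow> minkowski_metric n * (minkowski_metric n * B) = B"
  by (subst mult_assoc_dim[symmetric]) (auto intro: left_mult_one_mat)

lemma mat_adjoint_minkowski_metric [simp]: "mat_adjoint (minkowski_metric n) = minkowski_metric n"
  by (rule eq_matI) (auto simp: index_mat_adjoint minkowski_metric_def mat_diag_def)

lemma dim_minkowski_adjoint [simp]:
  "dim_row (minkowski_adjoint A) = dim_col A" "dim_col (minkowski_adjoint A) = dim_row A"
  by (simp_all add: minkowski_adjoint_def)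

lemma minkowski_adjoint_mult:
  assumes "dim_col A = dim_row B"
  shows "minkowski_adjoint (A * B) = minkowski_adjoint B * minkowski_adjoint A"
  using assms by (simp add: minkowski_adjoint_def mat_adjoint_mult mult_assoc_dim)

text \<open>As for the Moore-Penrose inverse: the classical argument uses only that the adjoint
  reverses products, and the Minkowski adjoint does so as well. It gives \<open>A * X = A * Y\<close> and \<open>X * A = Y * A\<close>, and then
  \<open>X = X * A * X = Y * A * Y = Y\<close>.\<close>

lemma minkowski_inverse_unique:
  assumes X: "is_minkowski_inverse A X" and Y: "is_minkowski_inverse A Y"
  shows "X = Y"
proof -
  have Xc: "dim_row X = dim_col A" "dim_col X = dim_row A" and X1: "A * X * A = A" and X2: "X * A * X = X"
    and X3: "minkowski_adjoint (A * X) = A * X" and X4: "minkowski_adjoint (X * A) = X * A"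
    using X by (auto simp: is_minkowski_inverse_def)
  have Yc: "dim_row Y = dim_col A" "dim_col Y = dim_row A" and Y1: "A * Y * A = A" and Y2: "Y * A * Y = Y"
    and Y3: "minkowski_adjoint (A * Y) = A * Y" and Y4: "minkowski_adjoint (Y * A) = Y * A"
    using Y by (auto simp: is_minkowski_inverse_def)
  note d = Xc Yc
  have "A * X = A * Y * A * X" unfolding Y1 ..
  also have "\<dots> = minkowski_adjoint (A * Y) * minkowski_adjoint (A * X)"
    unfolding X3 Y3 using d by (simp add: mult_assoc_dim)
  also have "\<dots> = minkowski_adjoint (A * X * A * Y)"
    using d by (subst minkowski_adjoint_mult[symmetric]) (auto simp: mult_assoc_dim)
  also have "\<dots> = A * Y" unfolding X1 Y3 ..
  finally have AX: "A * X = A * Y" .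
  have "X * A = X * (A * Y * A)" unfolding Y1 ..
  also have "\<dots> = minkowski_adjoint (X * A) * minkowski_adjoint (Y * A)"
    unfolding X4 Y4 using d by (simp add: mult_assoc_dim)
  also have "\<dots> = minkowski_adjoint (Y * (A * X * A))"
    using d by (subst minkowski_adjoint_mult[symmetric]) (auto simp: mult_assoc_dim)
  also have "\<dots> = Y * A" unfolding X1 Y4 ..
  finally have XA: "X * A = Y * A" .
  have "X = Y * A * X" using X2 unfolding XA by simp
  also have "\<dots> = Y * (A * X)" using d by (simp add: mult_assoc_dim)
  also have "\<dots> = Y * A * Y" unfolding AX using d by (simp add: mult_assoc_dim)
  finally show ?thesis unfolding Y2 .
qed

text \<open>MacDuffee's formula in the Minkowski metric, with \<open>G\<close> for the metric of either order. If both Gram matrices \<open>P\<^sup>* G P\<close> and \<open>Q G Q\<^sup>*\<close> of a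
  factorization are invertible, the Minkowski inverse of \<open>P * Q\<close> is
  \<open>G Q\<^sup>* (Q G Q\<^sup>*)\<^sup>-\<^sup>1 (P\<^sup>* G P)\<^sup>-\<^sup>1 P\<^sup>* G\<close>. Multiplied by \<open>P * Q\<close> from the left, the factor with \<open>Q\<close>
  cancels, so that only the oblique projection onto the range of \<open>P\<close> remains.\<close>

lemma mult_minkowski_inverse_factored:
  assumes P: "P \<in> carrier_mat n r" and Q: "Q \<in> carrier_mat r m"
    and N1: "mat_adjoint P * minkowski_metric n * P * M1 = 1\<^sub>m r"
            "M1 * (mat_adjoint P * minkowski_metric n * P) = 1\<^sub>m r" "M1 \<in> carrier_mat r r"
    and N2: "Q * minkowski_metric m * mat_adjoint Q * M2 = 1\<^sub>m r"
            "M2 * (Q * minkowski_metric m * mat_adjoint Q) = 1\<^sub>m r" "M2 \<in> carrier_mat r r"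
  shows "minkowski_inverse (P * Q) \<in> carrier_mat m n"
    and "P * Q * minkowski_inverse (P * Q) = P * M1 * mat_adjoint P * minkowski_metric n"
proof -
  let ?G = "minkowski_metric n" and ?H = "minkowski_metric m"
  define X where "X = ?H * mat_adjoint Q * (M2 * M1) * mat_adjoint P * ?G"
  define K1 where "K1 = mat_adjoint P * ?G * P"
  define K2 where "K2 = Q * ?H * mat_adjoint Q"
  note d = carrier_matD[OF P] carrier_matD[OF Q] carrier_matD[OF N1(3)] carrier_matD[OF N2(3)]
  have K: "K1 \<in> carrier_mat r r" "K2 \<in> carrier_mat r r" unfolding K1_def K2_def using d by auto
  have inv: "K1 * M1 = 1\<^sub>m r" "M1 * K1 = 1\<^sub>m r" "K2 * M2 = 1\<^sub>m r" "M2 * K2 = 1\<^sub>m r"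
    using N1 N2 unfolding K1_def K2_def by auto
  have herm: "mat_adjoint M1 = M1" "mat_adjoint M2 = M2"
    by (rule mat_adjoint_inverse_hermitian[OF K(1) N1(3) inv(2)],
        simp add: K1_def mat_adjoint_mult mult_assoc_dim d,
        rule mat_adjoint_inverse_hermitian[OF K(2) N2(3) inv(4)],
        simp add: K2_def mat_adjoint_mult mult_assoc_dim d)
  have AX: "P * Q * X = P * M1 * mat_adjoint P * ?G"
  proof -
    have "P * Q * X = P * (K2 * M2) * M1 * mat_adjoint P * ?G"
      unfolding X_def K2_def using d by (simp add: mult_assoc_dim)
    thus ?thesis unfolding inv using P by simp
  qed
  have XA: "X * (P * Q) = ?H * mat_adjoint Q * M2 * Q"
  proof -
    have "X * (P * Q) = ?H * mat_adjoint Q * M2 * (M1 * K1) * Q"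
      unfolding X_def K1_def using d by (simp add: mult_assoc_dim)
    also have "?H * mat_adjoint Q * M2 * (M1 * K1) = ?H * mat_adjoint Q * M2"
      unfolding inv using d by (intro right_mult_one_mat) auto
    finally show ?thesis .
  qed
  have "P * Q * X * (P * Q) = P * (M1 * K1) * Q"
    unfolding AX K1_def using d by (simp add: mult_assoc_dim)
  hence 1: "P * Q * X * (P * Q) = P * Q" unfolding inv using P by simp
  have "X * (P * Q) * X = ?H * mat_adjoint Q * (M2 * K2) * (M2 * M1) * mat_adjoint P * ?G"
    unfolding XA unfolding X_def K2_def using d by (simp add: mult_assoc_dim)
  also have "?H * mat_adjoint Q * (M2 * K2) = ?H * mat_adjoint Q"
    unfolding inv using d by (intro right_mult_one_mat) auto
  finally have 2: "X * (P * Q) * X = X" unfolding X_def .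
  have 3: "minkowski_adjoint (P * Q * X) = P * Q * X"
    unfolding AX minkowski_adjoint_def using d by (simp add: mat_adjoint_mult herm mult_assoc_dim)
  have 4: "minkowski_adjoint (X * (P * Q)) = X * (P * Q)"
    unfolding XA minkowski_adjoint_def using d
    by (simp add: mat_adjoint_mult herm mult_assoc_dim)
  have X: "is_minkowski_inverse (P * Q) X"
    unfolding is_minkowski_inverse_def using 1 2 3 4 d by (auto simp: X_def)
  hence "minkowski_inverse (P * Q) = X"
    unfolding minkowski_inverse_def using minkowski_inverse_unique by blast
  thus "minkowski_inverse (P * Q) \<in> carrier_mat m n"
    and "P * Q * minkowski_inverse (P * Q) = P * M1 * mat_adjoint P * ?G"
    using AX d by (auto simp: X_def)
qed

text \<open>Here the rank hypothesis enters. With \<open>A = P * Q\<close>, the matrix whose rank is prescribed is the product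
  \<open>(G Q\<^sup>*) (P\<^sup>* G P) (Q G Q\<^sup>*) (P\<^sup>* G)\<close>, so that both Gram matrices are square factors of order \<open>r\<close> of
  a matrix of rank \<open>r\<close>.\<close>

lemma gram_matrices_nonsingular:
  assumes P: "P \<in> carrier_mat n r" and Q: "Q \<in> carrier_mat r m"
    and rk: "mat_rank (minkowski_adjoint (P * Q) * (P * Q) * minkowski_adjoint (P * Q)) = r"
  shows "det (mat_adjoint P * minkowski_metric n * P) \<noteq> 0"
    and "det (Q * minkowski_metric m * mat_adjoint Q) \<noteq> 0"
proof -
  let ?G = "minkowski_metric n" and ?H = "minkowski_metric m"
  interpret vec_space "TYPE(complex)" m .
  define K1 where "K1 = mat_adjoint P * ?G * P"
  define K2 where "K2 = Q * ?H * mat_adjoint Q"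
  define M where "M = minkowski_adjoint (P * Q) * (P * Q) * minkowski_adjoint (P * Q)"
  note d = carrier_matD[OF P] carrier_matD[OF Q]
  have K: "K1 \<in> carrier_mat r r" "K2 \<in> carrier_mat r r" unfolding K1_def K2_def using d by auto
  have M1: "M = (?H * mat_adjoint Q) * K1 * (K2 * (mat_adjoint P * ?G))"
    and M2: "M = (?H * mat_adjoint Q * K1) * K2 * (mat_adjoint P * ?G)"
    unfolding M_def K1_def K2_def minkowski_adjoint_def using d
    by (simp_all add: mat_adjoint_mult mult_assoc_dim)
  have rk: "rank M = r" using rk d unfolding M_def by simp
  show "det (mat_adjoint P * ?G * P) \<noteq> 0"
    unfolding K1_def[symmetric]
    by (rule middle_factor_nonsingular[OF _ K(1) _ rk[unfolded M1]]) (use d K in auto)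
  show "det (Q * ?H * mat_adjoint Q) \<noteq> 0"
    unfolding K2_def[symmetric]
    by (rule middle_factor_nonsingular[OF _ K(2) _ rk[unfolded M2]]) (use d K in auto)
qed

section \<open>The m-DMP inverse of a factored matrix\<close>

text \<open>Cline's formula gives \<open>P D\<^sup>2 Q\<close> for the Drazin inverse, and \<open>A = P Q\<close> times its
  Minkowski inverse is \<open>P M\<^sub>1 P\<^sup>* G\<close>. Where the two meet, \<open>D\<^sup>2 (Q P)\<close> collapses to \<open>D\<close>.\<close>

lemma m_DMP_inverse_factored:
  assumes P: "P \<in> carrier_mat n r" and Q: "Q \<in> carrier_mat r n"
    and rk: "mat_rank (minkowski_adjoint (P * Q) * (P * Q) * minkowski_adjoint (P * Q)) = r"
    and M1: "mat_adjoint P * minkowski_metric n * P * M1 = 1\<^sub>m r"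
            "M1 * (mat_adjoint P * minkowski_metric n * P) = 1\<^sub>m r" "M1 \<in> carrier_mat r r"
  shows "m_DMP_inverse (P * Q) =
    P * (drazin_inverse (Q * P) * M1) * mat_adjoint P * minkowski_metric n"
proof -
  let ?G = "minkowski_metric n"
  define B where "B = Q * P"
  define D where "D = drazin_inverse B"
  have B: "B \<in> carrier_mat r r" unfolding B_def using P Q by simp
  have D: "drazin_equations B D" unfolding D_def by (rule drazin_inverse_equations[OF B])
  hence Dc: "D \<in> carrier_mat r r" and DBD: "D * B * D = D" and BD: "B * D = D * B"
    using B by (auto simp: drazin_equations_def)
  have "Q * ?G * mat_adjoint Q \<in> carrier_mat r r" using Q by auto
  then obtain M2 where M2: "M2 \<in> carrier_mat r r" "M2 * (Q * ?G * mat_adjoint Q) = 1\<^sub>m r"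
      "Q * ?G * mat_adjoint Q * M2 = 1\<^sub>m r"
    using inverse_exists gram_matrices_nonsingular(2)[OF P Q rk] by blast
  note d = carrier_matD[OF P] carrier_matD[OF Q] carrier_matD[OF Dc] carrier_matD[OF M1(3)] carrier_matD[OF B]
  have PQ: "P * Q \<in> carrier_mat n n" using P Q by simp
  have DPQ: "drazin_inverse (P * Q) = P * (D * D) * Q"
    by (rule drazin_inverse_eqI[OF PQ]) (rule cline_formula[OF P Q D[unfolded B_def]])
  have MPQ: "P * Q * minkowski_inverse (P * Q) = P * M1 * mat_adjoint P * ?G"
    and MPQc: "minkowski_inverse (P * Q) \<in> carrier_mat n n"
    using mult_minkowski_inverse_factored[OF P Q M1 M2(3,2,1)] by blast+
  have DDB: "D * D * B = D"
  proof -
    have "D * D * B = D * (D * B)" using d by (simp add: mult_assoc_dim)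
    also have "\<dots> = D * (B * D)" unfolding BD ..
    also have "\<dots> = D * B * D" using d by (simp add: mult_assoc_dim)
    finally show ?thesis unfolding DBD .
  qed
  have "m_DMP_inverse (P * Q) = drazin_inverse (P * Q) * (P * Q * minkowski_inverse (P * Q))"
    unfolding m_DMP_inverse_def DPQ using d carrier_matD[OF MPQc] by (simp add: mult_assoc_dim)
  also have "\<dots> = P * (D * D * B) * M1 * mat_adjoint P * ?G"
    unfolding DPQ MPQ B_def using d by (simp add: mult_assoc_dim)
  also have "\<dots> = P * (D * M1) * mat_adjoint P * ?G"
    unfolding DDB using d by (simp add: mult_assoc_dim)
  finally show ?thesis unfolding D_def B_def .
qed

section \<open>Block matrices with one block row or column\<close>

text \<open>The isometry of the first \<open>r\<close> coordinates into \<open>r + m\<close> coordinates. It and the block row below are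
  written as block matrices with some blocks empty, so that the product rule for four-block
  matrices applies to them.\<close>

definition block_inclusion :: "nat \<Rightarrow> nat \<Rightarrow> complex mat" where
  "block_inclusion r m = four_block_mat (1\<^sub>m r) (0\<^sub>m r 0) (0\<^sub>m m r) (0\<^sub>m m 0)"

definition block_row :: "complex mat \<Rightarrow> complex mat \<Rightarrow> complex mat" where
  "block_row B C = four_block_mat B C (0\<^sub>m 0 (dim_col B)) (0\<^sub>m 0 (dim_col C))"

lemma dim_block [simp]:
  "dim_row (block_inclusion r m) = r + m" "dim_col (block_inclusion r m) = r"
  "dim_row (block_row B C) = dim_row B" "dim_col (block_row B C) = dim_col B + dim_col C"
  by (simp_all add: block_inclusion_def block_row_def)

lemma four_block_empty:
  "A \<in> carrier_mat r c \<Longrightarrow> four_block_mat A (0\<^sub>m r 0) (0\<^sub>m 0 c) (0\<^sub>m 0 0) = A"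
  by (rule eq_matI) auto

lemma mat_adjoint_block_inclusion:
  "mat_adjoint (block_inclusion r m) = block_row (1\<^sub>m r) (0\<^sub>m r m)"
  unfolding block_inclusion_def block_row_def
  by (subst mat_adjoint_four_block[of _ r r _ 0 _ m]) simp_all

lemma block_inclusion_mult_row:
  assumes "B \<in> carrier_mat r r" "C \<in> carrier_mat r m"
  shows "block_inclusion r m * block_row B C = four_block_mat B C (0\<^sub>m m r) (0\<^sub>m m m)"
  unfolding block_inclusion_def block_row_def
  by (subst mult_four_block_mat[of _ r r _ 0 _ m _ _ r _ m]) (use assms in auto)

lemma block_row_mult_inclusion:
  assumes "B \<in> carrier_mat r r" "C \<in> carrier_mat r m"
  shows "block_row B C * block_inclusion r m = B"
  unfolding block_inclusion_def block_row_def
  by (subst mult_four_block_mat[of _ r r _ m _ 0 _ _ r _ 0])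
     (use assms four_block_empty[OF assms(1)] in auto)

lemma adjoint_block_inclusion_mult:
  assumes "A \<in> carrier_mat r r" "B \<in> carrier_mat r m" "C \<in> carrier_mat m r" "D \<in> carrier_mat m m"
  shows "mat_adjoint (block_inclusion r m) * four_block_mat A B C D = block_row A B"
  unfolding mat_adjoint_block_inclusion unfolding block_row_def
  by (subst mult_four_block_mat[of _ r r _ m _ 0 _ _ r _ m]) (use assms in auto)

lemma mult_block_row:
  assumes "M \<in> carrier_mat r r" "B \<in> carrier_mat r r" "C \<in> carrier_mat r m"
  shows "M * block_row B C = block_row (M * B) (M * C)"
proof -
  have "four_block_mat M (0\<^sub>m r 0) (0\<^sub>m 0 r) (0\<^sub>m 0 0) * block_row B C = block_row (M * B) (M * C)"
    unfolding block_row_def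
    by (subst mult_four_block_mat[of _ r r _ 0 _ 0 _ _ r _ m]) (use assms in auto)
  thus ?thesis unfolding four_block_empty[OF assms(1)] .
qed

section \<open>The m-DMP inverse in terms of the Hartwig-Spindelboeck decomposition\<close>

theorem theorem3p5:
  fixes A U K L G\<^sub>1 G\<^sub>2 G\<^sub>4 :: "complex mat" and \<sigma> :: "nat \<Rightarrow> real" and n r k :: nat
  defines "G \<equiv> minkowski_metric n"
    and "\<Sigma> \<equiv> mat_diag r (\<lambda>i. complex_of_real (\<sigma> i))"
  assumes A: "A \<in> carrier_mat n n"
    and index: "mat_index A = k"
    and rank: "mat_rank A = r"
    and minkowski: "mat_rank (minkowski_adjoint A * A * minkowski_adjoint A) = mat_rank A"
    and U: "U \<in> carrier_mat n n" "unitary_mat U"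
    and \<sigma>_pos: "\<And>i. i < r \<Longrightarrow> 0 < \<sigma> i"
    and \<sigma>_singular: "image_mset \<sigma> (mset_set {..<r}) = filter_mset (\<lambda>s. 0 < s) (singular_values A)"
    and K: "K \<in> carrier_mat r r"
    and L: "L \<in> carrier_mat r (n - r)"
    and KL: "K * mat_adjoint K + L * mat_adjoint L = 1\<^sub>m r"
    and A_decomp: "A = U * four_block_mat (\<Sigma> * K) (\<Sigma> * L)
                             (0\<^sub>m (n - r) r) (0\<^sub>m (n - r) (n - r)) * mat_adjoint U"
    and G\<^sub>1: "G\<^sub>1 \<in> carrier_mat r r"
    and G\<^sub>2: "G\<^sub>2 \<in> carrier_mat r (n - r)"
    and G\<^sub>4: "G\<^sub>4 \<in> carrier_mat (n - r) (n - r)"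
    and G_decomp: "G = U * four_block_mat G\<^sub>1 G\<^sub>2 (mat_adjoint G\<^sub>2) G\<^sub>4 * mat_adjoint U"
  shows "m_DMP_inverse A =
           U * four_block_mat (drazin_inverse (\<Sigma> * K) * mat_inv G\<^sub>1) (0\<^sub>m r (n - r))
                 (0\<^sub>m (n - r) r) (0\<^sub>m (n - r) (n - r)) * mat_adjoint U * G
       \<and> U * four_block_mat (drazin_inverse (\<Sigma> * K) * mat_inv G\<^sub>1) (0\<^sub>m r (n - r))
                 (0\<^sub>m (n - r) r) (0\<^sub>m (n - r) (n - r)) * mat_adjoint U * G =
           U * four_block_mat (drazin_inverse (\<Sigma> * K)) (drazin_inverse (\<Sigma> * K) * mat_inv G\<^sub>1 * G\<^sub>2)
                 (0\<^sub>m (n - r) r) (0\<^sub>m (n - r) (n - r)) * mat_adjoint U"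
proof -
  let ?D = "drazin_inverse (\<Sigma> * K)"
  define m where "m = n - r"
  interpret vec_space "TYPE(complex)" n .
  have "r \<le> n" using rank_le_nc[OF A] rank A by simp
  hence n: "n = r + m" unfolding m_def by simp
  have G: "dim_row G = n" "dim_col G = n" unfolding G_def by auto
  have Udim: "dim_row U = n" "dim_col U = n" using U(1) by auto
  have UU: "mat_adjoint U * U = 1\<^sub>m n"
    using U Udim unfolding unitary_mat_def inverts_mat_def by auto
  \<comment> \<open>The form in which the simplifier can cancel inside right-associated products.\<close>
  have UUl: "mat_adjoint U * (U * X) = X" if "dim_row X = n" for X
  proof -
    have "mat_adjoint U * (U * X) = mat_adjoint U * U * X" using Udim that by (simp add: mult_assoc_dim)
    also have "\<dots> = X" unfolding UU using that by (intro left_mult_one_mat) auto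
    finally show ?thesis .
  qed
  define J where "J = block_inclusion r m"
  define P where "P = U * J"
  define Q where "Q = block_row (\<Sigma> * K) (\<Sigma> * L) * mat_adjoint U"
  have \<Sigma>: "\<Sigma> \<in> carrier_mat r r" unfolding \<Sigma>_def by (simp add: mat_diag_def)
  have L': "L \<in> carrier_mat r m" using L unfolding m_def .
  have SK: "\<Sigma> * K \<in> carrier_mat r r" and SL: "\<Sigma> * L \<in> carrier_mat r m"
    using \<Sigma> K L' by auto
  have J: "J \<in> carrier_mat n r" unfolding J_def n by auto
  have P: "P \<in> carrier_mat n r" unfolding P_def using Udim J by auto
  have Q: "Q \<in> carrier_mat r n" unfolding Q_def using Udim carrier_matD[OF \<Sigma>] by auto
  have adjP: "mat_adjoint P = mat_adjoint J * mat_adjoint U"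
    unfolding P_def using Udim J by (simp add: mat_adjoint_mult)
  note [simp] = Udim G carrier_matD[OF J] carrier_matD[OF \<Sigma>] carrier_matD[OF K] carrier_matD[OF L']
    carrier_matD[OF P] carrier_matD[OF Q] carrier_matD[OF G\<^sub>1]
  have PQ: "A = P * Q"
    unfolding A_decomp P_def Q_def m_def[symmetric] block_inclusion_mult_row[OF SK SL, symmetric]
    using n by (simp add: mult_assoc_dim J_def[symmetric])
  have QP: "Q * P = \<Sigma> * K"
  proof -
    have "Q * P = block_row (\<Sigma> * K) (\<Sigma> * L) * J"
      unfolding Q_def P_def using n by (simp add: mult_assoc_dim UUl)
    thus ?thesis unfolding J_def block_row_mult_inclusion[OF SK SL] .
  qed
  have G2: "G\<^sub>2 \<in> carrier_mat r m" and G4: "G\<^sub>4 \<in> carrier_mat m m" using G\<^sub>2 G\<^sub>4 unfolding m_def by auto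
  have PG: "mat_adjoint P * G = block_row G\<^sub>1 G\<^sub>2 * mat_adjoint U"
  proof -
    have "mat_adjoint P * G = mat_adjoint J * four_block_mat G\<^sub>1 G\<^sub>2 (mat_adjoint G\<^sub>2) G\<^sub>4 * mat_adjoint U"
      unfolding adjP G_decomp using n G2 G4 by (simp add: mult_assoc_dim UUl)
    moreover have "mat_adjoint G\<^sub>2 \<in> carrier_mat m r" using G2 by (intro carrier_matI) auto
    ultimately show ?thesis unfolding J_def
      by (simp add: adjoint_block_inclusion_mult[OF G\<^sub>1 G2 _ G4])
  qed
  \<comment> \<open>The block \<open>G\<^sub>1\<close> is the Gram matrix of the first factor, hence nonsingular.\<close>
  have PGP: "mat_adjoint P * G * P = G\<^sub>1"
  proof -
    have "mat_adjoint P * G * P = block_row G\<^sub>1 G\<^sub>2 * J"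
      unfolding PG unfolding P_def using n G2 by (simp add: mult_assoc_dim UUl)
    thus ?thesis unfolding J_def block_row_mult_inclusion[OF G\<^sub>1 G2] .
  qed
  have rk: "mat_rank (minkowski_adjoint (P * Q) * (P * Q) * minkowski_adjoint (P * Q)) = r"
    using minkowski rank unfolding PQ by simp
  have "det G\<^sub>1 \<noteq> 0"
    using gram_matrices_nonsingular(1)[OF P Q rk] PGP unfolding G_def by simp
  note M = mat_inv_nonsingular[OF G\<^sub>1 this]
  have D: "?D \<in> carrier_mat r r"
    using drazin_inverse_equations[OF SK] SK by (auto simp: drazin_equations_def)
  note [simp] = carrier_matD[OF D] carrier_matD[OF M(1)]
  have DM: "?D * mat_inv G\<^sub>1 \<in> carrier_mat r r" using D M by simp
  have mid: "U * four_block_mat (?D * mat_inv G\<^sub>1) (0\<^sub>m r (n - r))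
                 (0\<^sub>m (n - r) r) (0\<^sub>m (n - r) (n - r)) * mat_adjoint U * G
      = P * (?D * mat_inv G\<^sub>1) * (mat_adjoint P * G)"
  proof -
    have "?D * mat_inv G\<^sub>1 * mat_adjoint J = block_row (?D * mat_inv G\<^sub>1) (0\<^sub>m r m)"
      unfolding J_def mat_adjoint_block_inclusion mult_block_row[OF DM one_carrier_mat zero_carrier_mat]
        right_mult_one_mat[OF DM] right_mult_zero_mat[OF DM] ..
    hence "four_block_mat (?D * mat_inv G\<^sub>1) (0\<^sub>m r m) (0\<^sub>m m r) (0\<^sub>m m m)
      = J * (?D * mat_inv G\<^sub>1 * mat_adjoint J)"
      unfolding J_def by (simp only: block_inclusion_mult_row[OF DM zero_carrier_mat])
    thus ?thesis unfolding m_def[symmetric] adjP unfolding P_def using n by (simp add: mult_assoc_dim)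
  qed
  have "m_DMP_inverse A = P * (?D * mat_inv G\<^sub>1) * mat_adjoint P * G"
    unfolding PQ QP[symmetric] G_def
    by (rule m_DMP_inverse_factored[OF P Q rk]) (use M PGP in \<open>auto simp: G_def\<close>)
  hence 1: "m_DMP_inverse A = P * (?D * mat_inv G\<^sub>1) * (mat_adjoint P * G)"
    by (simp add: mult_assoc_dim)
  have "P * (?D * mat_inv G\<^sub>1) * (mat_adjoint P * G)
      = U * (J * (?D * mat_inv G\<^sub>1 * block_row G\<^sub>1 G\<^sub>2)) * mat_adjoint U"
    unfolding PG unfolding P_def using n G2 by (simp add: mult_assoc_dim)
  also have "?D * mat_inv G\<^sub>1 * block_row G\<^sub>1 G\<^sub>2 = block_row ?D (?D * mat_inv G\<^sub>1 * G\<^sub>2)"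
    unfolding mult_block_row[OF DM G\<^sub>1 G2]
    using assoc_mult_mat[OF D M(1) G\<^sub>1] M(3) D by simp
  also have "J * \<dots> = four_block_mat ?D (?D * mat_inv G\<^sub>1 * G\<^sub>2) (0\<^sub>m m r) (0\<^sub>m m m)"
    unfolding J_def by (rule block_inclusion_mult_row) (use D DM G2 in auto)
  finally have 2: "P * (?D * mat_inv G\<^sub>1) * (mat_adjoint P * G) = U * four_block_mat ?D (?D * mat_inv G\<^sub>1 * G\<^sub>2)
      (0\<^sub>m (n - r) r) (0\<^sub>m (n - r) (n - r)) * mat_adjoint U" unfolding m_def .
  show ?thesis unfolding mid using 1 2 by simp
qed

end
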